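(* Let $\alpha_1,\dots,\alpha_n$ be distinct nonzero elements of $\mathbb{F}_q$, let $v_1,\dots,v_n\in\mathbb{F}_q^*$, let $0\le n-t\le n$, $0\le l\le n-t-1$, and let $\eta_1,\lambda_1\in\mathbb{F}_q$ be not both zero. Let $C=\mathrm{TGRS}_{n-t,n-t}(\boldsymbol\alpha,\boldsymbol v,l,\eta_1,\lambda_1)$ (see context) be an $[n,n-t,d]$ code, where $d=t$, or $d=t+1$ and $t$ is odd. Put $w_i=u_i/v_i$ with $u_i^{-1}=\prod_{j\ne i}(\alpha_i-\alpha_j)$. Let $\boldsymbol r=(r_1,\dots,r_n)\in\mathbb{F}_q^n$ be a received word with $d(\boldsymbol r,C)\le\lfloor\frac{d-1}{2}\rfloor$, with error word $\boldsymbol e=(e_1,\dots,e_n)$ and error location set $J=\{j:e_j\neq 0\}$, let $S(x)=\sum_{i=0}^{t-2}s_ix^i$ with $s_i=\sum_{j=1}^n r_jw_j\alpha_j^i=\sum_{j\in J}e_jw_j\alpha_j^i$ be its syndrome polynomial, and let $g(x)=x^{t-1}$. Let $\sigma_i(x),\tau_i(x)$, $i\in\{-1,0,\dots,v+1\}$, be the polynomials from the extended Euclid's Algorithm applied to $g(x)$ and $S(x)$ (see context). Let $h$ be the minimum index such that $\deg\tau_h(x)<\lfloor\frac{t-1}{2}\rfloor$. Then $(\sigma(x),\tau(x))=(\sigma_h(x),\tau_h(x))$ satisfies $$S(x)\sigma(x)\equiv\tau(x)\pmod{x^{t-1}},\qquad \gcd(\sigma(x),\tau(x))=1,\qquad \deg\tau(x)<\deg\sigma(x)=|J|\le\Big\lfloor\frac{d-1}{2}\Big\rfloor.$$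 Moreover, Algorithm A (given in the context) can be used to locate the error word $\boldsymbol e$.
   Context: $\mathbb{F}_q$ is the finite field with $q$ elements; $\deg0=-\infty$; $\sigma'$ is the formal derivative of $\sigma$. For $\boldsymbol\alpha=(\alpha_1,\dots,\alpha_n)$, $\boldsymbol v=(v_1,\dots,v_n)$, the code $\mathrm{TGRS}_{n-t,n-t}(\boldsymbol\alpha,\boldsymbol v,l,\eta_1,\lambda_1)$ is the $\mathbb{F}_q$-span in $\mathbb{F}_q^n$ of the vectors $(v_1\alpha_1^j,\dots,v_n\alpha_n^j)$ for $0\le j\le n-t-1$, $j\ne l$, together with $\big(v_1(\lambda_1\alpha_1^l+\eta_1\alpha_1^{n-t}),\dots,v_n(\lambda_1\alpha_n^l+\eta_1\alpha_n^{n-t})\big)$. $d(\boldsymbol r,C)$ is the minimum Hamming distance from $\boldsymbol r$ to $C$. The received word is $\boldsymbol r=\boldsymbol c+\boldsymbol e$ with $\boldsymbol c\in C$ and error word $\boldsymbol e$ having at most $\lfloor\frac{d-1}{2}\rfloor$ nonzero entries. Extended Euclid's Algorithm applied to $g\ne0$ and $S$ with $\deg g>\deg S$: set $\sigma_{-1}=0$, $\tau_{-1}=g$, $\sigma_0=1$, $\tau_0=S$; for $i\ge1$, as long as $\tau_{i-1}\ne0$, divide $\tau_{i-2}=q_i\tau_{i-1}+\tau_i$ with $\deg\tau_i<\deg\tau_{i-1}$ and set $\sigma_i=\sigma_{i-2}-q_i\sigma_{i-1}$; $v$ is the largest index with $\tau_v\ne0$ (so $\tau_{v+1}=0$). Algorithm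 A. Input $\boldsymbol r\in\mathbb{F}_q^n$; output $\boldsymbol c\in\mathbb{F}_q^n$. Step 1: compute $(s_0,\dots,s_{t-2})^T=H_1\boldsymbol r^T$, where $H_1$ is the matrix with rows $(w_1\alpha_1^i,\dots,w_n\alpha_n^i)$, $0\le i\le t-2$, and set $S(x)=\sum_{i=0}^{t-2}s_ix^i$. Step 2: set $\tau_{-1}=g=x^{t-1}$, $\tau_0=S$, $\sigma_{-1}=0$, $\sigma_0=1$, $k=-2$. Step 3: repeat { replace $k$ by $k+1$; let $q_{k+2}$ and $\tau_{k+2}$ be the quotient and remainder of $\tau_k$ divided by $\tau_{k+1}$; set $\sigma_{k+2}=\sigma_k-q_{k+2}\sigma_{k+1}$ } until $\deg\tau_{k+2}(x)<\frac t2$. Step 4: set $\sigma=\sigma_{k+2}$, $\tau=\tau_{k+2}$. Step 5: for $i=1,\dots,n$ set $e_i=-\frac{\alpha_i\tau(\alpha_i^{-1})}{w_i\sigma'(\alpha_i^{-1})}$ if $\sigma(\alpha_i^{-1})=0$, and $e_i=0$ otherwise. Step 6: output $\boldsymbol e=(e_1,\dots,e_n)$ and $\boldsymbol c=\boldsymbol r-\boldsymbol e$.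
   Formalization: In Algorithm A the stopping bound t/2 is replaced by ⌊t/2⌋ (with t/2 the claim fails, e.g. t=5, the length-6 repetition code over F_7, two errors), and for S=0 the undefined division by 0 is given quotient 0 and remainder equal to the dividend. *)

theory Defs
  imports
    "HOL-Analysis.Analysis"
    "HOL-Number_Theory.Cong"
    "HOL-Library.While_Combinator"
begin

text \<open>
  Words of length \<open>n\<close> over the field \<open>'a\<close> are vectors in \<open>'a ^ 'n\<close> with \<open>n = CARD('n)\<close>.
  Since \<open>'n\<close> is an arbitrary finite type, the coordinates are unordered labels.
\<close>

definition supp :: "'a::zero ^ 'n \<Rightarrow> 'n set" where
  "supp x = {i. x $ i \<noteq> 0}"

definition hamming_dist :: "'a ^ 'n::finite \<Rightarrow> 'a ^ 'n \<Rightarrow> nat" where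
  "hamming_dist x y = card {i. x $ i \<noteq> y $ i}"

definition dist_to_code :: "'a ^ 'n::finite \<Rightarrow> ('a ^ 'n) set \<Rightarrow> nat" where
  "dist_to_code r C = Min (hamming_dist r ` C)"

definition min_dist :: "('a ^ 'n::finite) set \<Rightarrow> nat" where
  "min_dist C = Min {hamming_dist x y | x y. x \<in> C \<and> y \<in> C \<and> x \<noteq> y}"

definition is_linear_code :: "('a::{finite,field} ^ 'n::finite) set \<Rightarrow> nat \<Rightarrow> nat \<Rightarrow> bool" where
  "is_linear_code C k d \<longleftrightarrow> vec.subspace C \<and> vec.dim C = k \<and> min_dist C = d"

text \<open>The code written \<open>TGRS\<^bsub>k,k\<^esub>(\<alpha>, v, l, \<eta>, \<lambda>)\<close>.\<close>

definition tgrs_code ::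
  "nat \<Rightarrow> 'a::{finite,field} ^ 'n::finite \<Rightarrow> 'a ^ 'n \<Rightarrow> nat \<Rightarrow> 'a \<Rightarrow> 'a \<Rightarrow> ('a ^ 'n) set" where
  "tgrs_code k \<alpha> v l \<eta> lam =
     vec.span ({(\<chi> i. v $ i * \<alpha> $ i ^ j) | j. j < k \<and> j \<noteq> l} \<union>
               {(\<chi> i. v $ i * (lam * \<alpha> $ i ^ l + \<eta> * \<alpha> $ i ^ k))})"

text \<open>The weights \<open>w\<^sub>i = u\<^sub>i / v\<^sub>i\<close> with \<open>u\<^sub>i\<^sup>-\<^sup>1 = \<Prod>j\<noteq>i. (\<alpha>\<^sub>i - \<alpha>\<^sub>j)\<close>.\<close>

definition dual_weights :: "'a::field ^ 'n::finite \<Rightarrow> 'a ^ 'n \<Rightarrow> 'a ^ 'n" where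
  "dual_weights \<alpha> v = (\<chi> i. inverse (\<Prod>j\<in>UNIV - {i}. \<alpha> $ i - \<alpha> $ j) / v $ i)"

definition syndrome :: "'a::field ^ 'n::finite \<Rightarrow> 'a ^ 'n \<Rightarrow> 'a ^ 'n \<Rightarrow> nat \<Rightarrow> 'a" where
  "syndrome \<alpha> w r i = (\<Sum>j\<in>UNIV. r $ j * w $ j * \<alpha> $ j ^ i)"

definition syndrome_poly :: "'a::field ^ 'n::finite \<Rightarrow> 'a ^ 'n \<Rightarrow> nat \<Rightarrow> 'a ^ 'n \<Rightarrow> 'a poly" where
  "syndrome_poly \<alpha> w t r = (\<Sum>i<t - 1. monom (syndrome \<alpha> w r i) i)"

text \<open>The degree with the convention \<open>deg 0 = -\<infinity>\<close>; the library's \<^const>\<open>degree\<close> gives \<open>0\<close> there.\<close>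

definition pdeg :: "'a::zero poly \<Rightarrow> ereal" where
  "pdeg p = (if p = 0 then -\<infinity> else ereal (real (degree p)))"

text \<open>
  The remainder and multiplier sequences of the extended Euclidean algorithm are numbered
  \<open>-1, 0, \<dots>, v + 1\<close>. The recursion below is shifted by one, so argument \<open>m\<close> stands for
  index \<open>m - 1\<close>. After the first zero remainder (index \<open>v + 1\<close>) both sequences are padded with
  \<open>0\<close>, so that \<open>v\<close> is the last index with a nonzero remainder.
\<close>

fun eea_tau_shift :: "'a::field poly \<Rightarrow> 'a poly \<Rightarrow> nat \<Rightarrow> 'a poly" where
  "eea_tau_shift g S 0 = g"
| "eea_tau_shift g S (Suc 0) = S"
| "eea_tau_shift g S (Suc (Suc m)) =
     (if eea_tau_shift g S (Suc m) = 0 then 0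
      else eea_tau_shift g S m mod eea_tau_shift g S (Suc m))"

fun eea_sigma_shift :: "'a::field poly \<Rightarrow> 'a poly \<Rightarrow> nat \<Rightarrow> 'a poly" where
  "eea_sigma_shift g S 0 = 0"
| "eea_sigma_shift g S (Suc 0) = 1"
| "eea_sigma_shift g S (Suc (Suc m)) =
     (if eea_tau_shift g S (Suc m) = 0 then 0
      else eea_sigma_shift g S m -
           (eea_tau_shift g S m div eea_tau_shift g S (Suc m)) * eea_sigma_shift g S (Suc m))"

definition eea_tau :: "'a::field poly \<Rightarrow> 'a poly \<Rightarrow> int \<Rightarrow> 'a poly" where
  "eea_tau g S i = eea_tau_shift g S (nat (i + 1))"

definition eea_sigma :: "'a::field poly \<Rightarrow> 'a poly \<Rightarrow> int \<Rightarrow> 'a poly" where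
  "eea_sigma g S i = eea_sigma_shift g S (nat (i + 1))"

definition eea_last :: "'a::field poly \<Rightarrow> 'a poly \<Rightarrow> int" where
  "eea_last g S = (GREATEST i. - 1 \<le> i \<and> eea_tau g S i \<noteq> 0)"

text \<open>The body is executed at least once; \<^const>\<open>None\<close> means that the loop does not terminate.\<close>

definition repeat_until :: "('s \<Rightarrow> bool) \<Rightarrow> ('s \<Rightarrow> 's) \<Rightarrow> 's \<Rightarrow> 's option" where
  "repeat_until stop body s = while_option (\<lambda>s. \<not> stop s) body (body s)"

text \<open>
  The decoding loop keeps \<open>(\<tau>\<^sub>k, \<tau>\<^sub>k\<^sub>+\<^sub>1, \<sigma>\<^sub>k, \<sigma>\<^sub>k\<^sub>+\<^sub>1)\<close>, starting at \<open>k = -1\<close>.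

  If \<open>S = 0\<close> (no errors), the first division is by \<open>0\<close>. The library's conventions
  \<open>p div 0 = 0\<close> and \<open>p mod 0 = p\<close> apply: the first pass swaps the two entries, and the
  second pass swaps them back and stops with \<open>\<sigma> = 1\<close>, \<open>\<tau> = 0\<close>.

  The bound \<open>t/2\<close> in the stopping test is the integer quotient \<open>t div 2\<close>. For even \<open>t\<close> this is
  the same number. For odd \<open>t\<close> the rational bound would also accept a remainder of degree
  \<open>(t - 1)/2\<close>, which is one division too early: already for \<open>t = 5\<close> and two errors the
  remainder degrees are in general \<open>4, 3, 2, 1\<close>, and stopping at degree \<open>2 < 5/2\<close> gives a
  multiplier of degree \<open>1\<close>, which cannot locate two errors.
\<close>

definition euclid_step ::
  "'a::field poly \<times> 'a poly \<times> 'a poly \<times> 'a poly \<Rightarrow> 'a poly \<times> 'a poly \<times> 'a poly \<times> 'a poly" where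
  "euclid_step = (\<lambda>(\<tau>, \<tau>', \<sigma>, \<sigma>'). (\<tau>', \<tau> mod \<tau>', \<sigma>', \<sigma> - (\<tau> div \<tau>') * \<sigma>'))"

definition error_values ::
  "'a::field ^ 'n::finite \<Rightarrow> 'a ^ 'n \<Rightarrow> 'a poly \<Rightarrow> 'a poly \<Rightarrow> 'a ^ 'n" where
  "error_values \<alpha> w \<sigma> \<tau> =
     (\<chi> i. if poly \<sigma> (inverse (\<alpha> $ i)) = 0
           then - (\<alpha> $ i * poly \<tau> (inverse (\<alpha> $ i)) /
                   (w $ i * poly (pderiv \<sigma>) (inverse (\<alpha> $ i))))
           else 0)"

definition algorithm_A ::
  "'a::field ^ 'n::finite \<Rightarrow> 'a ^ 'n \<Rightarrow> nat \<Rightarrow> 'a ^ 'n \<Rightarrow> (('a ^ 'n) \<times> ('a ^ 'n)) option" where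
  "algorithm_A \<alpha> w t r =
     map_option (\<lambda>(_, \<tau>, _, \<sigma>). let e = error_values \<alpha> w \<sigma> \<tau> in (e, r - e))
       (repeat_until (\<lambda>(_, \<tau>, _, _). pdeg \<tau> < ereal (real (t div 2))) euclid_step
          (monom 1 (t - 1), syndrome_poly \<alpha> w t r, 0, 1))"

end

theory Submission
  imports Defs
begin

text \<open>
  The syndromes vanish on the code, because \<open>\<Sum>i. u\<^sub>i \<alpha>\<^sub>i\<^sup>m\<close> is the coefficient at \<open>x\<^bsup>n - 1\<^esup>\<close> of the
  Lagrange interpolant of \<open>x\<^sup>m\<close>, which is \<open>0\<close> for \<open>m < n - 1\<close>. Hence \<open>S\<close> depends only on the error, and
  \<open>L = \<Prod>j\<in>J. (1 - \<alpha>\<^sub>j x)\<close> satisfies the key equation \<open>L S = \<omega>\<close> modulo \<open>x\<^bsup>t - 1\<^esup>\<close> with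
  \<open>deg \<omega> < |J|\<close> and \<open>L, \<omega>\<close> coprime. At the first remainder of degree below a bound \<open>B\<close> with
  \<open>|J| \<le> B \<le> t - 1 - |J|\<close>, comparison of degrees forces the Euclidean pair to be a constant multiple of
  \<open>(L, \<omega>)\<close>. Both \<open>(t - 1) div 2\<close> and \<open>t div 2\<close> are such bounds, and Forney's formula for the error
  values is unaffected by the constant.
\<close>

section \<open>Syndromes of codewords\<close>

text \<open>Since \<open>degree p < card I\<close>, \<open>p\<close> is its own Lagrange interpolant
  \<open>q\<close> on the nodes. Each basis product \<open>b i\<close> is monic of degree
  \<open>card I - 1\<close>, so the top coefficient of \<open>q\<close> is the sum of the weights
  \<open>c i\<close>.\<close>

lemma sum_poly_over_node_products:
  fixes x :: "'i \<Rightarrow> 'a::field"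
  assumes "finite I" "inj_on x I" "degree p < card I"
  shows "(\<Sum>i\<in>I. poly p (x i) * inverse (\<Prod>j\<in>I - {i}. x i - x j)) = coeff p (card I - 1)"
proof -
  define c where "c i = poly p (x i) * inverse (\<Prod>j\<in>I - {i}. x i - x j)" for i
  define b where "b i = (\<Prod>j\<in>I - {i}. [:- x j, 1:])" for i
  define q where "q = (\<Sum>i\<in>I. smult (c i) (b i))"
  have db: "degree (b i) = card I - 1" if "i \<in> I" for i
    unfolding b_def using assms that by (subst degree_prod_sum_eq) auto
  have lb: "coeff (b i) (card I - 1) = 1" if "i \<in> I" for i
    using lead_coeff_prod[of "\<lambda>j. [:- x j, 1:]" "I - {i}"] db[OF that] by (simp add: b_def)
  have card: "card (x ` I) = card I"
    using assms(2) by (rule card_image)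
  have pos: "card I > 0"
    using assms(3) by simp
  have "degree q \<le> card I - 1"
    unfolding q_def using db assms(1)
    by (intro degree_sum_le) (auto intro: order_trans[OF degree_smult_le])
  hence "degree q < card I"
    using pos by simp
  have "poly q (x k) = poly p (x k)" if k: "k \<in> I" for k
  proof -
    have "poly (b i) (x k) = 0" if "i \<in> I - {k}" for i
      using that k assms(1) by (auto simp: b_def poly_prod)
    hence "poly q (x k) = c k * poly (b k) (x k)"
      unfolding q_def using assms(1) k by (simp add: poly_sum sum.remove[of I k])
    also have "poly (b k) (x k) = (\<Prod>j\<in>I - {k}. x k - x j)"
      by (simp add: b_def poly_prod)
    also have "c k * \<dots> = poly p (x k)"
    proof -
      have "(\<Prod>j\<in>I - {k}. x k - x j) \<noteq> 0"
        using assms k by (auto simp: inj_on_def)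
      thus ?thesis by (simp add: c_def)
    qed
    finally show ?thesis .
  qed
  hence "q = p"
    using \<open>degree q < card I\<close> assms(3) card by (intro poly_eqI_degree[of "x ` I"]) auto
  moreover have "coeff q (card I - 1) = sum c I"
    unfolding q_def using lb by (simp add: coeff_sum)
  ultimately show ?thesis
    by (simp add: c_def)
qed

lemma sum_power_over_node_products_eq_0:
  fixes x :: "'i \<Rightarrow> 'a::field"
  assumes "finite I" "inj_on x I" "m + 1 < card I"
  shows "(\<Sum>i\<in>I. inverse (\<Prod>j\<in>I - {i}. x i - x j) * x i ^ m) = 0"
  using sum_poly_over_node_products[of I x "monom 1 m"] assms
  by (simp add: poly_monom degree_monom_eq mult.commute)

section \<open>Linearity of the syndromes and their vanishing on the code\<close>

lemma syndrome_add: "syndrome \<alpha> w (x + y) i = syndrome \<alpha> w x i + syndrome \<alpha> w y i"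
  by (simp add: syndrome_def sum.distrib algebra_simps)

lemma syndrome_scale: "syndrome \<alpha> w (a *s x) i = a * syndrome \<alpha> w x i"
  by (simp add: syndrome_def sum_distrib_left algebra_simps)

text \<open>The factor \<open>1 / v\<close> in the dual weights cancels the column multipliers of a
  generator, leaving node sums of powers with exponent \<open>m + i\<close>. The twisted generator
  combines the exponents \<open>l\<close> and \<open>k\<close>, so \<open>m = k\<close> must be
  covered too; this fixes the range of \<open>i\<close>.\<close>

lemma syndrome_tgrs_code_eq_0:
  fixes \<alpha> v :: "'a::{finite,field} ^ 'n::finite"
  assumes "inj (\<lambda>i. \<alpha> $ i)" "\<And>i. v $ i \<noteq> 0" "l < k" "k + i + 1 < CARD('n)"
    and "c \<in> tgrs_code k \<alpha> v l \<eta> lam"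
  shows "syndrome \<alpha> (dual_weights \<alpha> v) c i = 0"
proof -
  let ?w = "dual_weights \<alpha> v"
  have mono: "syndrome \<alpha> ?w (\<chi> j. v $ j * \<alpha> $ j ^ m) i = 0" if "m \<le> k" for m
  proof -
    have "syndrome \<alpha> ?w (\<chi> j. v $ j * \<alpha> $ j ^ m) i =
        (\<Sum>j\<in>UNIV. inverse (\<Prod>m\<in>UNIV - {j}. \<alpha> $ j - \<alpha> $ m) * \<alpha> $ j ^ (m + i))"
      using assms(2) by (simp add: syndrome_def dual_weights_def power_add) (simp add: ac_simps)
    also have "\<dots> = 0"
      using assms that by (intro sum_power_over_node_products_eq_0) auto
    finally show ?thesis .
  qed
  have twist: "(\<chi> j. v $ j * (lam * \<alpha> $ j ^ l + \<eta> * \<alpha> $ j ^ k)) =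
      lam *s (\<chi> j. v $ j * \<alpha> $ j ^ l) + \<eta> *s (\<chi> j. v $ j * \<alpha> $ j ^ k)"
    by (simp add: vec_eq_iff algebra_simps)
  show ?thesis
    using assms(5) unfolding tgrs_code_def
  proof (induction rule: vec.span_induct_alt)
    case base
    show ?case by (simp add: syndrome_def)
  next
    case (step a x y)
    have "syndrome \<alpha> ?w x i = 0"
      using step(1) mono assms(3) unfolding twist
      by (auto simp: syndrome_add syndrome_scale)
    thus ?case using step by (simp add: syndrome_add syndrome_scale)
  qed
qed

section \<open>The key equation\<close>

text \<open>In reciprocal form: the roots are the inverses of the locations \<open>x j\<close>,
  which is why Algorithm A evaluates at inverses.\<close>

definition locator :: "('i \<Rightarrow> 'a::field) \<Rightarrow> 'i set \<Rightarrow> 'a poly" where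
  "locator x J = (\<Prod>j\<in>J. [:1, - x j:])"

text \<open>The numerator of the sum of \<open>f j / (1 - x j X)\<close> over the common denominator
  \<open>locator x J\<close>.\<close>

definition evaluator :: "('i \<Rightarrow> 'a::field) \<Rightarrow> ('i \<Rightarrow> 'a) \<Rightarrow> 'i set \<Rightarrow> 'a poly" where
  "evaluator x f J = (\<Sum>j\<in>J. smult (f j) (locator x (J - {j})))"

lemma locator_remove:
  "finite J \<Longrightarrow> j \<in> J \<Longrightarrow> locator x J = [:1, - x j:] * locator x (J - {j})"
  unfolding locator_def by (rule prod.remove)

lemma locator_nonzero: "locator x J \<noteq> 0"
  unfolding locator_def by (cases "finite J") auto

lemma degree_locator:
  assumes "\<And>j. j \<in> J \<Longrightarrow> x j \<noteq> 0"
  shows "degree (locator x J) = card J"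
  unfolding locator_def using assms by (subst degree_prod_sum_eq) auto

lemma poly_locator_inverse_eq_0_iff:
  assumes "finite J" "\<And>j. j \<in> J \<Longrightarrow> x j \<noteq> 0" "x i \<noteq> 0"
  shows "poly (locator x J) (inverse (x i)) = 0 \<longleftrightarrow> x i \<in> x ` J"
  using assms by (auto simp: locator_def poly_prod field_simps)

text \<open>Every summand with index other than \<open>j\<close> retains the factor
  \<open>1 - x j X\<close>, which vanishes at this point.\<close>

lemma poly_evaluator_inverse:
  assumes "finite J" "j \<in> J" "x j \<noteq> 0"
  shows "poly (evaluator x f J) (inverse (x j)) = f j * poly (locator x (J - {j})) (inverse (x j))"
proof -
  have "poly (locator x (J - {i})) (inverse (x j)) = 0" if "i \<in> J - {j}" for i
    using that assms by (auto simp: locator_def poly_prod intro!: bexI[of _ j])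
  thus ?thesis
    unfolding evaluator_def using assms by (simp add: poly_sum sum.remove[of J j])
qed

text \<open>In the product rule only the derivative of the factor \<open>1 - x j X\<close> survives
  at its own root.\<close>

lemma poly_pderiv_locator_inverse:
  assumes "finite J" "j \<in> J" "x j \<noteq> 0"
  shows "poly (pderiv (locator x J)) (inverse (x j)) =
    - x j * poly (locator x (J - {j})) (inverse (x j))"
  unfolding locator_remove[OF assms(1,2)] pderiv_mult
  using assms(3) by (simp add: pderiv_pCons del: mult_pCons_left)

lemma degree_evaluator:
  assumes "\<And>j. j \<in> J \<Longrightarrow> x j \<noteq> 0"
  shows "evaluator x f J = 0 \<or> degree (evaluator x f J) < card J"
proof (cases "finite J \<and> J \<noteq> {}")
  case True
  have "degree (locator x (J - {j})) = card J - 1" if "j \<in> J" for j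
    using True assms that degree_locator[of "J - {j}" x] by auto
  hence "degree (evaluator x f J) \<le> card J - 1"
    unfolding evaluator_def using True
    by (intro degree_sum_le) auto
  moreover have "card J > 0" using True by (simp add: card_gt_0_iff)
  ultimately show ?thesis by linarith
qed (auto simp: evaluator_def)

text \<open>A polynomial with no root in common with a product of linear factors is a unit modulo
  each factor, hence modulo the product; repeated factors do no harm.\<close>

lemma bezout_locator:
  assumes "finite J" "\<And>j. j \<in> J \<Longrightarrow> poly p (inverse (x j)) \<noteq> 0" "\<And>j. j \<in> J \<Longrightarrow> x j \<noteq> 0"
  shows "\<exists>a b. a * locator x J + b * p = 1"
  using assms
proof (induction J rule: finite_induct)
  case empty
  have "1 * locator x {} + 0 * p = 1" by (simp add: locator_def)
  thus ?case by blast
next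
  case (insert j J)
  then obtain a b where ab: "a * locator x J + b * p = 1" by auto
  define y where "y = inverse (x j)"
  \<comment> \<open>Modulo the new linear factor, \<open>p\<close> is the nonzero constant
    \<open>poly p y\<close>; dividing by it gives a Bezout identity for that factor alone.\<close>
  have "[:- y, 1:] dvd p - [:poly p y:]"
    by (simp add: poly_eq_0_iff_dvd[symmetric])
  then obtain s where s: "p - [:poly p y:] = [:- y, 1:] * s" ..
  define m where "m = [:1, - x j:]"
  have "x j \<noteq> 0" using insert.prems(2) by auto
  hence lin: "[:- y, 1:] = smult (- y) m" by (simp add: y_def m_def)
  define u where "u = inverse (poly p y)"
  have "poly p y \<noteq> 0" using insert.prems(1) by (auto simp: y_def)
  hence "[:u:] * [:poly p y:] = 1" by (simp add: u_def one_pCons)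
  hence "[:u:] * (p - [:- y, 1:] * s) = 1"
    using s by (metis add_diff_cancel_left' diff_add_cancel)
  hence *: "smult (u * y) s * m + [:u:] * p = 1"
    unfolding lin by (simp add: algebra_simps)
  define a' b' where "a' = smult (u * y) s" and "b' = [:u:]"
  have l: "locator x (insert j J) = m * locator x J"
    using insert.hyps by (simp add: locator_def m_def)
  \<comment> \<open>Multiplying the two identities leaves one term with the full locator; all others
    contain \<open>p\<close>.\<close>
  have "1 = (a * locator x J + b * p) * (a' * m + b' * p)"
    using ab * by (simp only: a'_def b'_def) simp
  also have "\<dots> = (a * a') * locator x (insert j J) +
      (a * locator x J * b' + b * (a' * m + b' * p)) * p"
    unfolding l by (simp only: algebra_simps)
  finally show ?case by metis
qed

text \<open>At each root of the locator the evaluator is \<open>f j\<close> times a product that is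
  nonzero because the locations are distinct.\<close>

lemma bezout_locator_evaluator:
  assumes "finite J" "inj_on x J" "\<And>j. j \<in> J \<Longrightarrow> x j \<noteq> 0" "\<And>j. j \<in> J \<Longrightarrow> f j \<noteq> 0"
  shows "\<exists>a b. a * locator x J + b * evaluator x f J = 1"
proof (rule bezout_locator)
  fix j assume j: "j \<in> J"
  have "x j \<notin> x ` (J - {j})" using assms(2) j by (auto simp: inj_on_def)
  hence "poly (locator x (J - {j})) (inverse (x j)) \<noteq> 0"
    using assms j by (subst poly_locator_inverse_eq_0_iff) auto
  thus "poly (evaluator x f J) (inverse (x j)) \<noteq> 0"
    using assms j by (simp add: poly_evaluator_inverse)
qed (use assms in auto)

lemma linear_mult_geometric:
  fixes a :: "'a::field"
  shows "[:1, - a:] * (\<Sum>i<N. monom (a ^ i) i) = 1 - monom (a ^ N) N"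
proof (induction N)
  case (Suc N)
  have "[:1, - a:] * monom (a ^ N) N = monom (a ^ N) N - monom (a ^ Suc N) (Suc N)"
    by (simp add: monom_Suc smult_monom minus_monom)
  thus ?case using Suc by (simp add: distrib_left)
qed simp

text \<open>Modulo \<open>x\<^sup>N\<close> the syndrome polynomial is \<open>\<Sum>j\<in>J. f j / (1 - x j X)\<close>.\<close>

lemma key_equation:
  fixes x f :: "'i \<Rightarrow> 'a::field"
  assumes "finite J"
  shows "\<exists>\<mu>. locator x J * (\<Sum>i<N. monom (\<Sum>j\<in>J. f j * x j ^ i) i) + \<mu> * monom 1 N =
    evaluator x f J"
proof -
  have S: "(\<Sum>i<N. monom (\<Sum>j\<in>J. f j * x j ^ i) i) =
      (\<Sum>j\<in>J. smult (f j) (\<Sum>i<N. monom (x j ^ i) i))"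
    by (simp add: poly_eq_iff coeff_sum)
  \<comment> \<open>Each geometric series truncated at \<open>N\<close> leaves the error
    \<open>x j ^ N\<close> times \<open>monom 1 N\<close>; \<open>\<mu>\<close> collects these
    errors.\<close>
  define \<mu> where "\<mu> = (\<Sum>j\<in>J. smult (f j * x j ^ N) (locator x (J - {j})))"
  have "locator x J * smult (f j) (\<Sum>i<N. monom (x j ^ i) i) =
      smult (f j) (locator x (J - {j})) - smult (f j * x j ^ N) (locator x (J - {j})) * monom 1 N"
    if "j \<in> J" for j
  proof -
    have "locator x J * smult (f j) (\<Sum>i<N. monom (x j ^ i) i) =
        smult (f j) (locator x (J - {j}) * ([:1, - x j:] * (\<Sum>i<N. monom (x j ^ i) i)))"
      unfolding locator_remove[OF assms that] by (simp only: mult_smult_right ac_simps)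
    also have "\<dots> = smult (f j) (locator x (J - {j}) * (1 - smult (x j ^ N) (monom 1 N)))"
      unfolding linear_mult_geometric by (simp add: smult_monom)
    finally show ?thesis by (simp add: algebra_simps smult_diff_right)
  qed
  hence "locator x J * (\<Sum>i<N. monom (\<Sum>j\<in>J. f j * x j ^ i) i) =
      evaluator x f J - \<mu> * monom 1 N"
    unfolding S evaluator_def \<mu>_def
    by (simp add: sum_distrib_left sum_distrib_right sum_subtractf)
  thus ?thesis by (intro exI[of _ \<mu>]) simp
qed

text \<open>Forney's formula: at the inverse of a location, evaluator and derivative share the
  cofactor \<open>locator x (J - {i})\<close>, and the scalar \<open>k\<close> cancels in the
  quotient. Elsewhere the locator has no root at the inverse, so the value is
  \<open>0\<close>.\<close>

lemma error_values_locator_evaluator: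
  fixes \<alpha> w e :: "'a::field ^ 'n::finite"
  assumes "inj (\<lambda>i. \<alpha> $ i)" "\<And>i. \<alpha> $ i \<noteq> 0" "\<And>i. w $ i \<noteq> 0" "k \<noteq> 0"
  shows "error_values \<alpha> w (smult k (locator (($) \<alpha>) (supp e)))
    (smult k (evaluator (($) \<alpha>) (\<lambda>j. e $ j * w $ j) (supp e))) = e"
proof -
  let ?J = "supp e" and ?x = "($) \<alpha>"
  have mem: "?x i \<in> ?x ` J \<longleftrightarrow> i \<in> J" for i J
    using assms(1) by (auto simp: inj_on_def)
  have zero: "poly (locator ?x J) (inverse (\<alpha> $ i)) = 0 \<longleftrightarrow> i \<in> J" for i J
    using poly_locator_inverse_eq_0_iff[of J ?x i] assms mem by auto
  have "error_values \<alpha> w (smult k (locator ?x ?J))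
      (smult k (evaluator ?x (\<lambda>j. e $ j * w $ j) ?J)) $ i = e $ i" for i
  proof (cases "i \<in> ?J")
    case True
    moreover have "poly (locator ?x (?J - {i})) (inverse (\<alpha> $ i)) \<noteq> 0"
      by (simp add: zero)
    ultimately show ?thesis
      using assms
      by (simp add: error_values_def zero pderiv_smult poly_pderiv_locator_inverse
          poly_evaluator_inverse)
  next
    case False
    thus ?thesis using assms(4) by (simp add: error_values_def zero) (simp add: supp_def)
  qed
  thus ?thesis by (simp add: vec_eq_iff)
qed

section \<open>The extended Euclidean algorithm\<close>

text \<open>The loop does not compute the cofactors of \<open>g\<close>, so they are quantified.
  Their determinant is only required to be a unit, which avoids tracking its alternating sign. The
  multiplier degrees are compared weakly because \<open>0\<close> and \<open>1\<close> both have
  \<open>degree\<close> zero at the start.\<close>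

definition euclid_invariant ::
  "'a::field poly \<Rightarrow> 'a poly \<Rightarrow> 'a poly \<times> 'a poly \<times> 'a poly \<times> 'a poly \<Rightarrow> bool" where
  "euclid_invariant g S = (\<lambda>(\<tau>, \<tau>', \<sigma>, \<sigma>').
     \<tau> \<noteq> 0 \<and> (\<tau>' = 0 \<or> degree \<tau>' < degree \<tau>) \<and>
     \<sigma>' \<noteq> 0 \<and> degree \<sigma> \<le> degree \<sigma>' \<and> degree \<sigma>' + degree \<tau> = degree g \<and>
     (\<exists>\<rho> \<rho>'. \<sigma> * S + \<rho> * g = \<tau> \<and> \<sigma>' * S + \<rho>' * g = \<tau>' \<and> (\<sigma> * \<rho>' - \<sigma>' * \<rho>) dvd 1))"

lemma euclid_invariant_init:
  assumes "g \<noteq> 0" "S = 0 \<or> degree S < degree g"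
  shows "euclid_invariant g S (g, S, 0, 1)"
proof -
  have "0 * S + 1 * g = g \<and> 1 * S + 0 * g = S \<and> (0 * 0 - 1 * 1 :: 'a poly) dvd 1" by simp
  thus ?thesis using assms unfolding euclid_invariant_def by force
qed

text \<open>The quotient moves exactly the degree lost by the remainder into the multiplier, and the
  step negates the determinant.\<close>

lemma euclid_invariant_step:
  assumes "euclid_invariant g S (\<tau>, \<tau>', \<sigma>, \<sigma>')" "\<tau>' \<noteq> 0"
  shows "euclid_invariant g S (euclid_step (\<tau>, \<tau>', \<sigma>, \<sigma>'))"
proof -
  let ?q = "\<tau> div \<tau>'"
  from assms obtain \<rho> \<rho>' where
    inv: "\<tau> \<noteq> 0" "degree \<tau>' < degree \<tau>" "\<sigma>' \<noteq> 0" "degree \<sigma> \<le> degree \<sigma>'"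
      "degree \<sigma>' + degree \<tau> = degree g" and
    bez: "\<sigma> * S + \<rho> * g = \<tau>" "\<sigma>' * S + \<rho>' * g = \<tau>'" "(\<sigma> * \<rho>' - \<sigma>' * \<rho>) dvd 1"
    by (auto simp: euclid_invariant_def)
  have div: "\<tau> = ?q * \<tau>' + \<tau> mod \<tau>'" by simp
  have rem: "\<tau> mod \<tau>' = 0 \<or> degree (\<tau> mod \<tau>') < degree \<tau>'"
    using assms(2) by (rule degree_mod_less)
  have "?q \<noteq> 0"
  proof
    assume "?q = 0"
    hence "\<tau> mod \<tau>' = \<tau>" using div_mult_mod_eq[of \<tau> \<tau>'] by simp
    thus False using inv(1,2) rem by simp
  qed
  hence dq: "degree (?q * \<tau>') = degree ?q + degree \<tau>'" and dqs: "degree (?q * \<sigma>') = degree ?q + degree \<sigma>'"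
    using assms(2) inv(3) by (simp_all add: degree_mult_eq)
  have "degree \<tau> = degree (?q * \<tau>')"
  proof (cases "\<tau> mod \<tau>' = 0")
    case True thus ?thesis using div by simp
  next
    case False
    hence "degree (\<tau> mod \<tau>') < degree (?q * \<tau>')" using rem dq by simp
    thus ?thesis using div by (metis degree_add_eq_left)
  qed
  hence dt: "degree \<tau> = degree ?q + degree \<tau>'" using dq by simp
  \<comment> \<open>Strict because the falling remainder degrees force \<open>degree ?q > 0\<close>;
    hence no leading term cancels in the new multiplier.\<close>
  hence lt: "degree \<sigma> < degree (?q * \<sigma>')" using inv dqs by linarith
  have ds: "degree (\<sigma> - ?q * \<sigma>') = degree ?q + degree \<sigma>'"
    using degree_add_eq_right[of \<sigma> "- (?q * \<sigma>')"] lt dqs by simp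
  have nz: "\<sigma> - ?q * \<sigma>' \<noteq> 0" using lt by auto
  have "(\<sigma> - ?q * \<sigma>') * S + (\<rho> - ?q * \<rho>') * g = (\<sigma> * S + \<rho> * g) - ?q * (\<sigma>' * S + \<rho>' * g)"
    by (simp add: algebra_simps)
  also have "\<dots> = \<tau> mod \<tau>'" unfolding bez by (simp add: minus_div_mult_eq_mod)
  finally have b': "(\<sigma> - ?q * \<sigma>') * S + (\<rho> - ?q * \<rho>') * g = \<tau> mod \<tau>'" .
  have "\<sigma>' * (\<rho> - ?q * \<rho>') - (\<sigma> - ?q * \<sigma>') * \<rho>' = - (\<sigma> * \<rho>' - \<sigma>' * \<rho>)"
    by (simp add: algebra_simps)
  hence "(\<sigma>' * (\<rho> - ?q * \<rho>') - (\<sigma> - ?q * \<sigma>') * \<rho>') dvd 1"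
    using bez(3) by (simp only: minus_dvd_iff)
  with b' bez(2) have "\<exists>\<rho> \<rho>''. \<sigma>' * S + \<rho> * g = \<tau>' \<and>
      (\<sigma> - ?q * \<sigma>') * S + \<rho>'' * g = \<tau> mod \<tau>' \<and> (\<sigma>' * \<rho>'' - (\<sigma> - ?q * \<sigma>') * \<rho>) dvd 1"
    by blast
  thus ?thesis
    using assms(2) rem nz ds dt inv unfolding euclid_invariant_def euclid_step_def by auto
qed

text \<open>
  Both \<open>\<omega> \<sigma>'\<close> and \<open>\<tau>' L\<close> have degree below that of \<open>g\<close> and are congruent modulo \<open>g\<close>, so they are
  equal; since \<open>L, \<omega>\<close> are coprime, \<open>\<sigma>' = k L\<close>. The same \<open>k\<close> divides the cofactor \<open>\<rho>'\<close>, hence the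
  unit determinant, and is therefore constant.
\<close>

lemma euclid_invariant_unique:
  assumes inv: "euclid_invariant g S (\<tau>, \<tau>', \<sigma>, \<sigma>')" and g: "g \<noteq> 0"
    and B: "B \<le> degree \<tau>" "\<tau>' = 0 \<or> degree \<tau>' < B" "degree L \<le> B" "B + degree L \<le> degree g"
    and key: "L * S + \<mu> * g = \<omega>" and w: "\<omega> = 0 \<or> degree \<omega> < degree L" "L \<noteq> 0"
    and bez: "a * L + b * \<omega> = 1"
  shows "\<exists>k. k \<noteq> 0 \<and> \<sigma>' = smult k L \<and> \<tau>' = smult k \<omega>"
proof -
  from inv obtain \<rho> \<rho>' where i: "\<tau> \<noteq> 0" "\<sigma>' \<noteq> 0" "degree \<sigma>' + degree \<tau> = degree g"
    and r: "\<sigma>' * S + \<rho>' * g = \<tau>'" "(\<sigma> * \<rho>' - \<sigma>' * \<rho>) dvd 1"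
    by (auto simp: euclid_invariant_def)
  \<comment> \<open>The previous remainder has degree at least \<open>B \<ge> degree L\<close>,
    which bounds \<open>degree \<sigma>'\<close> by \<open>degree g - degree L\<close>. The second
    bound uses \<open>degree \<tau>' < B\<close> and
    \<open>B + degree L \<le> degree g\<close>.\<close>
  have 1: "\<omega> * \<sigma>' = 0 \<or> degree (\<omega> * \<sigma>') < degree g"
    using w i B degree_mult_eq[of \<omega> \<sigma>'] by (cases "\<omega> = 0") auto
  have 2: "\<tau>' * L = 0 \<or> degree (\<tau>' * L) < degree g"
    using w i B degree_mult_eq[of \<tau>' L] by (cases "\<tau>' = 0") auto
  have eq: "\<omega> * \<sigma>' - \<tau>' * L = g * (\<mu> * \<sigma>' - \<rho>' * L)"
    unfolding key[symmetric] r(1)[symmetric] by (simp add: algebra_simps)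
  have z: "\<mu> * \<sigma>' - \<rho>' * L = 0"
  proof (rule ccontr)
    assume nz: "\<mu> * \<sigma>' - \<rho>' * L \<noteq> 0"
    have ge: "degree (\<omega> * \<sigma>' - \<tau>' * L) \<ge> degree g" and ne: "\<omega> * \<sigma>' - \<tau>' * L \<noteq> 0"
      unfolding eq using nz g by (auto simp: degree_mult_eq)
    show False
    proof (cases "\<omega> * \<sigma>' = 0 \<or> \<tau>' * L = 0")
      case True
      thus False using 1 2 ge ne by auto
    next
      case False
      hence "degree (\<omega> * \<sigma>' - \<tau>' * L) < degree g"
        using 1 2 by (intro degree_diff_less) auto
      thus False using ge by simp
    qed
  qed
  hence e1: "\<omega> * \<sigma>' = \<tau>' * L" using eq by simp
  have e2: "\<mu> * \<sigma>' = \<rho>' * L" using z by simp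
  \<comment> \<open>The cofactor of \<open>L\<close> obtained by multiplying the Bezout identity by
    \<open>\<sigma>'\<close> and replacing \<open>\<omega> * \<sigma>'\<close> by
    \<open>\<tau>' * L\<close>.\<close>
  define k where "k = a * \<sigma>' + b * \<tau>'"
  have "\<sigma>' = (a * L + b * \<omega>) * \<sigma>'" using bez by simp
  also have "\<dots> = a * \<sigma>' * L + b * (\<omega> * \<sigma>')" by (simp only: algebra_simps)
  also have "\<dots> = k * L" unfolding e1 k_def by (simp only: algebra_simps)
  finally have s: "\<sigma>' = k * L" .
  have t: "\<tau>' = k * \<omega>"
  proof -
    have "\<tau>' * L = k * \<omega> * L" using e1[symmetric] unfolding s by (simp only: ac_simps)
    thus ?thesis using w(2) by (metis mult_right_cancel)
  qed
  have "\<rho>' * L = \<mu> * k * L" using e2[symmetric] unfolding s by (simp only: ac_simps)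
  hence "\<rho>' = \<mu> * k" using w(2) by (metis mult_right_cancel)
  hence "k dvd \<sigma> * \<rho>' - \<sigma>' * \<rho>" using s by (intro dvd_diff) auto
  hence "k dvd 1" using r(2) dvd_trans by blast
  then obtain c where "k = [:c:]" "c \<noteq> 0" using i(2) s by (auto simp: is_unit_poly_iff)
  thus ?thesis using s t by (intro exI[of _ c]) auto
qed

section \<open>The indexed Euclidean sequences and their stopping index\<close>

definition eea_state ::
  "'a::field poly \<Rightarrow> 'a poly \<Rightarrow> nat \<Rightarrow> 'a poly \<times> 'a poly \<times> 'a poly \<times> 'a poly" where
  "eea_state g S m = (eea_tau_shift g S m, eea_tau_shift g S (Suc m),
     eea_sigma_shift g S m, eea_sigma_shift g S (Suc m))"

lemma eea_state_0: "eea_state g S 0 = (g, S, 0, 1)"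
  by (simp add: eea_state_def)

text \<open>The nonzero divisor matters: after a zero remainder the sequences are padded with
  \<open>0\<close>, whereas \<open>euclid_step\<close> would swap entries.\<close>

lemma eea_state_Suc:
  "eea_tau_shift g S (Suc m) \<noteq> 0 \<Longrightarrow> eea_state g S (Suc m) = euclid_step (eea_state g S m)"
  by (simp add: eea_state_def euclid_step_def)

lemma eea_tau_shift_nonzero_pred:
  "g \<noteq> 0 \<Longrightarrow> eea_tau_shift g S (Suc m) \<noteq> 0 \<Longrightarrow> eea_tau_shift g S m \<noteq> 0"
  by (cases m) auto

lemma euclid_invariant_eea_state:
  assumes "g \<noteq> 0" "S = 0 \<or> degree S < degree g" "eea_tau_shift g S m \<noteq> 0"
  shows "euclid_invariant g S (eea_state g S m)"
  using assms(3)
proof (induction m)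
  case 0
  show ?case using assms by (simp add: eea_state_0 euclid_invariant_init)
next
  case (Suc m)
  have "euclid_invariant g S (eea_state g S m)"
    using Suc eea_tau_shift_nonzero_pred[OF assms(1)] by blast
  thus ?case
    unfolding eea_state_Suc[OF Suc.prems]
    using Suc.prems by (auto simp: eea_state_def intro!: euclid_invariant_step)
qed

text \<open>Each division lowers the degree by at least one, so no nonzero remainder lies beyond
  position \<open>degree g\<close>. This yields termination and makes \<open>eea_last\<close> well
  defined.\<close>

lemma degree_eea_tau_shift:
  assumes "g \<noteq> 0" "S = 0 \<or> degree S < degree g" "eea_tau_shift g S m \<noteq> 0"
  shows "degree (eea_tau_shift g S m) + m \<le> degree g"
  using assms(3)
proof (induction m)
  case (Suc m)
  have nz: "eea_tau_shift g S m \<noteq> 0" using Suc.prems eea_tau_shift_nonzero_pred[OF assms(1)] by blast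
  have "degree (eea_tau_shift g S (Suc m)) < degree (eea_tau_shift g S m)"
    using euclid_invariant_eea_state[OF assms(1,2) nz] Suc.prems
    by (auto simp: euclid_invariant_def eea_state_def)
  thus ?case using Suc.IH[OF nz] by simp
qed simp

lemma pdeg_less_iff: "pdeg p < ereal (real B) \<longleftrightarrow> p = 0 \<or> degree p < B"
  by (simp add: pdeg_def)

lemma eea_stopping_index:
  assumes g: "g \<noteq> 0" "S = 0 \<or> degree S < degree g" and "B \<le> degree g"
  obtains p where "eea_tau_shift g S p \<noteq> 0"
    "pdeg (eea_tau_shift g S (Suc p)) < ereal (real B)"
    "\<And>m. m \<le> p \<Longrightarrow> \<not> pdeg (eea_tau_shift g S m) < ereal (real B)"
proof -
  let ?P = "\<lambda>m. pdeg (eea_tau_shift g S m) < ereal (real B)"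
  have "eea_tau_shift g S (Suc (degree g)) = 0"
    using degree_eea_tau_shift[OF g, of "Suc (degree g)"] by linarith
  hence ex: "?P (Suc (degree g))" by (simp add: pdeg_def)
  define M where "M = (LEAST m. ?P m)"
  have PM: "?P M" unfolding M_def using ex by (rule LeastI)
  have min: "\<not> ?P m" if "m < M" for m
    using that unfolding M_def by (rule not_less_Least)
  \<comment> \<open>As \<open>B \<le> degree g\<close>, the polynomial \<open>g\<close> itself is
    not accepted, so the first accepted position has a predecessor.\<close>
  have "\<not> ?P 0" using assms unfolding pdeg_less_iff by simp
  then obtain p where p: "M = Suc p" using PM by (cases M) auto
  have "eea_tau_shift g S p \<noteq> 0" using min[of p] p unfolding pdeg_less_iff by auto
  thus thesis using that[of p] PM min p by simp
qed

text \<open>Position \<open>Suc p\<close> of the shifted sequence is index \<open>p\<close>. The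
  accepted remainder may be the first zero one, hence the range up to
  \<open>eea_last g S + 1\<close>.\<close>

lemma Least_eea_tau_index:
  assumes g: "g \<noteq> 0" "S = 0 \<or> degree S < degree g"
    and p: "eea_tau_shift g S p \<noteq> 0" "P (eea_tau_shift g S (Suc p))"
      "\<And>m. m \<le> p \<Longrightarrow> \<not> P (eea_tau_shift g S m)"
  shows "(LEAST i. - 1 \<le> i \<and> i \<le> eea_last g S + 1 \<and> P (eea_tau g S i)) = int p"
proof -
  let ?A = "{m. eea_tau_shift g S m \<noteq> 0}"
  have "?A \<subseteq> {..degree g}"
    using degree_eea_tau_shift[OF g] by fastforce
  hence fin: "finite ?A" using finite_subset by blast
  have last: "eea_last g S = int (Max ?A) - 1"
    unfolding eea_last_def
  proof (rule Greatest_equality)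
    show "- 1 \<le> int (Max ?A) - 1 \<and> eea_tau g S (int (Max ?A) - 1) \<noteq> 0"
      using Max_in[OF fin] p(1) by (auto simp: eea_tau_def)
  next
    fix i assume i: "- 1 \<le> i \<and> eea_tau g S i \<noteq> 0"
    hence "nat (i + 1) \<le> Max ?A" using fin by (intro Max_ge) (auto simp: eea_tau_def)
    thus "i \<le> int (Max ?A) - 1" by linarith
  qed
  have "p \<le> Max ?A" using p(1) fin by (intro Max_ge) auto
  show ?thesis
  proof (rule Least_equality)
    show "- 1 \<le> int p \<and> int p \<le> eea_last g S + 1 \<and> P (eea_tau g S (int p))"
      using last \<open>p \<le> Max ?A\<close> p(2) by (simp add: eea_tau_def nat_add_distrib)
  next
    fix i assume i: "- 1 \<le> i \<and> i \<le> eea_last g S + 1 \<and> P (eea_tau g S i)"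
    hence "\<not> nat (i + 1) \<le> p" using p(3)[of "nat (i + 1)"] by (auto simp: eea_tau_def)
    thus "int p \<le> i" by linarith
  qed
qed

text \<open>The body runs once before the first test, so the while loop starts from state 1 and
  \<open>p \<ge> 1\<close> is required. By \<open>P 0\<close>, every rejected remainder is nonzero,
  so each pass follows the indexed sequence.\<close>

lemma repeat_until_euclid_step:
  assumes "S \<noteq> 0" "p \<ge> 1" "P (eea_tau_shift g S (Suc p))" "P 0"
    and "\<And>m. m \<le> p \<Longrightarrow> \<not> P (eea_tau_shift g S m)"
  shows "repeat_until (\<lambda>(_, \<tau>, _, _). P \<tau>) euclid_step (g, S, 0, 1) = Some (eea_state g S p)"
proof -
  let ?b = "\<lambda>s. \<not> P (fst (snd s))"
  have b: "(\<lambda>(_, \<tau>, _, _). P \<tau>) = (\<lambda>s. P (fst (snd s)))"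
    by (auto simp: fun_eq_iff)
  have "while_option ?b euclid_step (eea_state g S m) = Some (eea_state g S p)" if "m \<le> p" for m
    using that
  proof (induction rule: inc_induct)
    case base
    show ?case using assms(3) by (subst while_option_unfold) (simp add: eea_state_def)
  next
    case (step m)
    have "\<not> P (eea_tau_shift g S (Suc m))" using assms(5) step by simp
    hence "?b (eea_state g S m)" and "eea_tau_shift g S (Suc m) \<noteq> 0"
      using assms(4) by (auto simp: eea_state_def)
    thus ?case using step by (subst while_option_unfold) (simp add: eea_state_Suc)
  qed
  from this[of 1] assms(1,2) show ?thesis
    using eea_state_Suc[of g S 0] by (simp add: repeat_until_def eea_state_0 b)
qed

lemma repeat_until_euclid_step_0:
  assumes "\<not> P g" "P 0"
  shows "repeat_until (\<lambda>(_, \<tau>, _, _). P \<tau>) euclid_step (g, 0, 0, 1) = Some (g, 0, 0, 1)"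
  unfolding repeat_until_def using assms
  by (subst while_option_unfold, subst while_option_unfold) (simp add: euclid_step_def)

section \<open>Decoding\<close>

lemma syndrome_poly_eq:
  assumes "\<And>i. i < t - 1 \<Longrightarrow> syndrome \<alpha> w r i = (\<Sum>j\<in>J. f j * \<alpha> $ j ^ i)"
  shows "syndrome_poly \<alpha> w t r = (\<Sum>i<t - 1. monom (\<Sum>j\<in>J. f j * \<alpha> $ j ^ i) i)"
  unfolding syndrome_poly_def using assms by (intro sum.cong) auto

lemma degree_syndrome_poly:
  "syndrome_poly \<alpha> w t r = 0 \<or> degree (syndrome_poly \<alpha> w t r) < t - 1"
proof (cases "t - 1 = 0")
  case False
  have "degree (syndrome_poly \<alpha> w t r) \<le> t - 1 - 1"
    unfolding syndrome_poly_def
    by (intro degree_sum_le) (auto intro!: order_trans[OF degree_monom_le])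
  thus ?thesis using False by linarith
qed (simp add: syndrome_poly_def)

text \<open>The bound \<open>B\<close> stays free so that the same argument serves both the index
  \<open>h\<close> and the stopping test of the loop.\<close>

lemma euclid_stop_locator:
  fixes x f :: "'i \<Rightarrow> 'a::field"
  assumes J: "finite J" "inj_on x J" "\<And>j. j \<in> J \<Longrightarrow> x j \<noteq> 0" "\<And>j. j \<in> J \<Longrightarrow> f j \<noteq> 0"
    and S: "S = (\<Sum>i<N. monom (\<Sum>j\<in>J. f j * x j ^ i) i)" "S = 0 \<or> degree S < N"
    and B: "card J \<le> B" "B + card J \<le> N"
    and p: "eea_tau_shift (monom 1 N) S p \<noteq> 0"
      "\<not> pdeg (eea_tau_shift (monom 1 N) S p) < ereal (real B)"
      "pdeg (eea_tau_shift (monom 1 N) S (Suc p)) < ereal (real B)"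
  obtains k where "k \<noteq> 0" "eea_sigma_shift (monom 1 N) S (Suc p) = smult k (locator x J)"
    "eea_tau_shift (monom 1 N) S (Suc p) = smult k (evaluator x f J)"
proof -
  let ?g = "monom 1 N :: 'a poly"
  have dg: "?g \<noteq> 0" "degree ?g = N" by (simp_all add: degree_monom_eq)
  obtain \<mu> where key: "locator x J * S + \<mu> * ?g = evaluator x f J"
    using key_equation[OF J(1), of x f N] S(1) by auto
  obtain a b where bez: "a * locator x J + b * evaluator x f J = 1"
    using bezout_locator_evaluator[of J x f] J by blast
  have deg: "degree (locator x J) = card J" using J(3) by (rule degree_locator)
  have "euclid_invariant ?g S (eea_state ?g S p)"
    using dg S(2) p(1) by (intro euclid_invariant_eea_state) auto
  then show thesis
    using euclid_invariant_unique[OF _ dg(1) _ _ _ _ key _ locator_nonzero bez, where B = B]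
      p(2,3) B deg dg degree_evaluator[of J x f] J(3) that
    unfolding eea_state_def pdeg_less_iff by (metis not_less)
qed

theorem theorem5p4:
  fixes \<alpha> v w r c e :: "'a::{finite,field} ^ 'n::finite"
    and t l d :: nat and \<eta> lam :: 'a and C :: "('a ^ 'n) set"
    and g S :: "'a poly" and h :: int
  assumes "inj (\<lambda>i. \<alpha> $ i)" and "\<And>i. \<alpha> $ i \<noteq> 0" and "\<And>i. v $ i \<noteq> 0"
    and "t \<le> CARD('n)" and "l < CARD('n) - t"
    and "\<not> (\<eta> = 0 \<and> lam = 0)"
    and "C = tgrs_code (CARD('n) - t) \<alpha> v l \<eta> lam"
    and "is_linear_code C (CARD('n) - t) d"
    and "d = t \<or> (d = t + 1 \<and> odd t)"
    and "w = dual_weights \<alpha> v"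
    and "dist_to_code r C \<le> (d - 1) div 2"
    and "r = c + e" and "c \<in> C" and "card (supp e) \<le> (d - 1) div 2"
    and "S = syndrome_poly \<alpha> w t r"
    and "g = monom 1 (t - 1)"
    and "h = (LEAST i. - 1 \<le> i \<and> i \<le> eea_last g S + 1 \<and>
                pdeg (eea_tau g S i) < ereal (real ((t - 1) div 2)))"
  shows "(\<forall>i<t - 1. syndrome \<alpha> w r i = (\<Sum>j\<in>supp e. e $ j * w $ j * \<alpha> $ j ^ i)) \<and>
    [S * eea_sigma g S h = eea_tau g S h] (mod monom 1 (t - 1)) \<and>
    coprime (eea_sigma g S h) (eea_tau g S h) \<and>
    pdeg (eea_tau g S h) < pdeg (eea_sigma g S h) \<and>
    pdeg (eea_sigma g S h) = ereal (real (card (supp e))) \<and>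
    card (supp e) \<le> (d - 1) div 2 \<and>
    algorithm_A \<alpha> w t r = Some (e, c)"
proof -
  define N where "N = t - 1"
  define B where "B = (t - 1) div 2"
  define J where "J = supp e"
  define x where "x = ($) \<alpha>"
  define f where "f = (\<lambda>j. e $ j * w $ j)"
  have t: "card J \<le> B" "B + card J \<le> N" "card J \<le> t div 2" "t div 2 + card J \<le> N"
  proof -
    \<comment> \<open>For \<open>d = t + 1\<close> with \<open>t\<close> odd, both sides are
      \<open>t div 2\<close>.\<close>
    have "(d - 1) div 2 = (t - 1) div 2" using assms(9) by (auto elim!: oddE)
    hence "card J \<le> (t - 1) div 2" using assms(14) by (simp add: J_def)
    thus "card J \<le> B" "B + card J \<le> N" "card J \<le> t div 2" "t div 2 + card J \<le> N"
      unfolding B_def N_def by linarith+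
  qed
  have w: "w $ i \<noteq> 0" for i
    using assms(1,3) by (auto simp: assms(10) dual_weights_def inj_eq)
  have J: "finite J" "inj_on x J" "\<And>j. j \<in> J \<Longrightarrow> x j \<noteq> 0" "\<And>j. j \<in> J \<Longrightarrow> f j \<noteq> 0"
    using assms(1,2) w by (auto simp: J_def x_def f_def supp_def inj_on_def inj_def)
  have synd: "syndrome \<alpha> w r i = (\<Sum>j\<in>J. f j * \<alpha> $ j ^ i)" if "i < t - 1" for i
  proof -
    \<comment> \<open>With \<open>k = CARD('n) - t\<close>, the range required for vanishing is
      exactly \<open>i < t - 1\<close>.\<close>
    have "syndrome \<alpha> w c i = 0"
      unfolding assms(10) using assms(13,5,4,1,3) that
      by (intro syndrome_tgrs_code_eq_0[where k = "CARD('n) - t" and l = l]) (auto simp: assms(7))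
    moreover have "syndrome \<alpha> w e i = (\<Sum>j\<in>J. f j * \<alpha> $ j ^ i)"
      unfolding syndrome_def J_def f_def by (intro sum.mono_neutral_right) (auto simp: supp_def)
    ultimately show ?thesis by (simp add: assms(12) syndrome_add)
  qed
  have S: "S = (\<Sum>i<N. monom (\<Sum>j\<in>J. f j * x j ^ i) i)" "S = 0 \<or> degree S < N"
    using syndrome_poly_eq[where f = f and J = J and t = t and \<alpha> = \<alpha> and w = w and r = r] synd degree_syndrome_poly[of \<alpha> w t r]
    by (auto simp: assms(15) N_def x_def)
  have g: "g = monom 1 N" "g \<noteq> 0" "degree g = N"
    by (simp_all add: assms(16) N_def degree_monom_eq)
  have Sg: "S = 0 \<or> degree S < degree g" using S(2) g by simp
  have stop: "\<exists>k. k \<noteq> 0 \<and> eea_sigma_shift g S (Suc p) = smult k (locator x J) \<and>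
      eea_tau_shift g S (Suc p) = smult k (evaluator x f J)"
    if "card J \<le> B" "B + card J \<le> N" "eea_tau_shift g S p \<noteq> 0"
      "\<not> pdeg (eea_tau_shift g S p) < ereal (real B)"
      "pdeg (eea_tau_shift g S (Suc p)) < ereal (real B)" for B p
    by (rule euclid_stop_locator[OF J(1,2) _ _ S that[unfolded g(1)], folded g(1)])
      (use J(3,4) in blast)+
  have alg: "algorithm_A \<alpha> w t r = Some (e, c)"
  proof -
    \<comment> \<open>The loop may stop at an index other than \<open>h\<close>; its pair is still a
      scalar multiple of locator and evaluator.\<close>
    let ?P = "\<lambda>\<tau>. pdeg \<tau> < ereal (real (t div 2))"
    obtain p where p: "eea_tau_shift g S p \<noteq> 0" "?P (eea_tau_shift g S (Suc p))"
      "\<And>m. m \<le> p \<Longrightarrow> \<not> ?P (eea_tau_shift g S m)"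
      using eea_stopping_index[OF g(2) Sg, of "t div 2"] t g by auto
    obtain k where k: "k \<noteq> 0" "eea_sigma_shift g S (Suc p) = smult k (locator x J)"
      "eea_tau_shift g S (Suc p) = smult k (evaluator x f J)"
      using stop[OF t(3,4) p(1) p(3)[OF order_refl] p(2)] by blast
    have "\<exists>\<tau> \<sigma>. repeat_until (\<lambda>(_, \<tau>, _, _). ?P \<tau>) euclid_step (g, S, 0, 1) =
        Some (\<tau>, eea_tau_shift g S (Suc p), \<sigma>, eea_sigma_shift g S (Suc p))"
    proof (cases "S = 0")
      case True
      have "eea_tau_shift g S (Suc m) = 0" for m
        using True by (induction m) auto
      hence "p = 0" using p(1) by (cases p) auto
      moreover have "\<not> ?P g" using p(3)[of 0] by simp
      ultimately show ?thesis
        using True repeat_until_euclid_step_0[where P = ?P and g = g] by (simp add: pdeg_def)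
    next
      case False
      \<comment> \<open>Stopping at \<open>p = 0\<close> would make the constant \<open>1\<close> a
        multiple of the locator, so there would be no errors and \<open>S\<close> would
        vanish.\<close>
      have "p \<noteq> 0"
      proof
        assume "p = 0"
        hence "smult k (locator x J) = 1" using k by simp
        hence "degree (locator x J) = 0" using k(1) by (metis degree_1 degree_smult_eq)
        hence "J = {}" using J degree_locator[of J x] by simp
        thus False using S(1) False by simp
      qed
      thus ?thesis
        using repeat_until_euclid_step[where P = ?P and S = S and p = p and g = g] False p by (simp add: pdeg_def eea_state_def)
    qed
    moreover have "error_values \<alpha> w (smult k (locator x J)) (smult k (evaluator x f J)) = e"
      unfolding x_def f_def J_def
      using assms(1,2) w k(1) by (intro error_values_locator_evaluator) auto
    ultimately show ?thesis
      unfolding algorithm_A_def assms(15)[symmetric] assms(16)[symmetric]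
      by (auto simp: Let_def k assms(12))
  qed
  obtain p where p: "eea_tau_shift g S p \<noteq> 0" "pdeg (eea_tau_shift g S (Suc p)) < ereal (real B)"
    "\<And>m. m \<le> p \<Longrightarrow> \<not> pdeg (eea_tau_shift g S m) < ereal (real B)"
    using eea_stopping_index[OF g(2) Sg, of B] t g by auto
  obtain k where k: "k \<noteq> 0" "eea_sigma_shift g S (Suc p) = smult k (locator x J)"
    "eea_tau_shift g S (Suc p) = smult k (evaluator x f J)"
    using stop[OF t(1,2) p(1) p(3)[OF order_refl] p(2)] by blast
  have "h = int p"
    unfolding assms(17) B_def[symmetric]
    using Least_eea_tau_index[OF g(2) Sg p(1), where P = "\<lambda>\<tau>. pdeg \<tau> < ereal (real B)"] p
    by blast
  hence h: "eea_sigma g S h = smult k (locator x J)" "eea_tau g S h = smult k (evaluator x f J)"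
    using k by (simp_all add: eea_sigma_def eea_tau_def nat_add_distrib)
  have "[S * eea_sigma g S h = eea_tau g S h] (mod monom 1 (t - 1))"
  proof -
    obtain \<mu> where "locator x J * S + \<mu> * g = evaluator x f J"
      using key_equation[OF J(1), of x f N] S(1) g(1) by auto
    hence "S * smult k (locator x J) - smult k (evaluator x f J) = g * smult (- k) \<mu>"
      by (simp add: algebra_simps flip: smult_add_right)
    thus ?thesis unfolding h cong_iff_dvd_diff assms(16)[symmetric] by (rule dvdI)
  qed
  moreover have "coprime (eea_sigma g S h) (eea_tau g S h)"
  proof (rule coprimeI)
    fix q assume "q dvd eea_sigma g S h" "q dvd eea_tau g S h"
    hence "q dvd locator x J" "q dvd evaluator x f J"
      unfolding h using k(1) by (auto simp: dvd_smult_iff)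
    moreover obtain a b where "a * locator x J + b * evaluator x f J = 1"
      using bezout_locator_evaluator[of J x f] J by blast
    ultimately show "q dvd 1" by (metis dvd_add dvd_mult)
  qed
  moreover have "pdeg (eea_sigma g S h) = ereal (real (card (supp e)))"
    using k(1) J locator_nonzero[of x J] by (simp add: h pdeg_def degree_locator J_def)
  \<comment> \<open>With no errors the evaluator is \<open>0\<close> and \<open>pdeg\<close> gives
    minus infinity, so the inequality remains strict.\<close>
  moreover have "pdeg (eea_tau g S h) < \<dots>"
    using degree_evaluator[of J x f] J(3) k(1) unfolding pdeg_less_iff h by (auto simp: J_def)
  ultimately show ?thesis
    using synd alg assms(14) by (simp add: J_def f_def)
qed

end
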